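(* Let $n\ge 1$, let $W=(w_{ij})_{n\times n}$ be a row-stochastic matrix, let $\beta\in(0,1)$ and let $\alpha>1$. Consider the best-response opinion dynamics $$x(k+1)=\beta x(k)+(1-\beta)\operatorname{BR}^\alpha(x(k);W),\qquad k\in\mathbb{N},$$ on the influence network $\mathcal{G}(W)$. Then for any initial state $x(0)\in\mathbb{R}^n$, the solution $x(k)$ always converges, as $k\to\infty$, to an equilibrium.
   Context: A matrix $W=(w_{ij})_{n\times n}$ is row-stochastic if all its entries are nonnegative and each row sums to $1$. $\mathcal{G}(W)$ is the weighted directed graph on the node set $\{1,\dots,n\}$ with a link from $i$ to $j$ (of weight $w_{ij}$) if and only if $w_{ij}>0$. $\mathbb{N}=\{0,1,2,\dots\}$. Social cost: for $x\in\mathbb{R}^n$, $z\in\mathbb{R}$ and $i\in\{1,\dots,n\}$, $u_i(z;x)=\sum_{j=1}^n w_{ij}|z-x_j|^\alpha$. Best-response operator: for $\alpha>0$, $\operatorname{BR}^\alpha(x;W)\in\mathbb{R}^n$ (also written $\operatorname{BR}^\alpha(x,W)$) has $i$-th component $\operatorname{BR}^\alpha_i(x;W)$ determined by: (1) $\operatorname{BR}^\alpha_i(x;W)\in\arg\min_{z\in\mathbb{R}}u_i(z;x)$; (2) $|\operatorname{BR}^\alpha_i(x;W)-x_i|\le|z^*-x_i|$ for all $z^*\in\arg\min_{z\in\mathbb{R}}u_i(z;x)$; (3) if two distinct minimizers $z_1,z_2$ of $u_i(\cdot;x)$ both attain the minimal distance to $x_i$ among all minimizers, then $\operatorname{BR}^\alpha_i(x;W)=\min\{z_1,z_2\}$.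 (For $\alpha>1$ the minimizer is unique.) An equilibrium is a vector $x^*\in\mathbb{R}^n$ with $x^*=\beta x^*+(1-\beta)\operatorname{BR}^\alpha(x^*;W)$. *)

theory Defs
  imports "HOL-Analysis.Analysis"
begin

definition row_stochastic :: "real ^ 'n ^ 'n \<Rightarrow> bool" where
  "row_stochastic W \<longleftrightarrow>
     (\<forall>i j. 0 \<le> W $ i $ j) \<and> (\<forall>i. (\<Sum>j\<in>UNIV. W $ i $ j) = 1)"

definition social_cost ::
    "real \<Rightarrow> real ^ 'n ^ 'n \<Rightarrow> 'n \<Rightarrow> real \<Rightarrow> real ^ 'n \<Rightarrow> real" where
  "social_cost \<alpha> W i z x = (\<Sum>j\<in>UNIV. W $ i $ j * \<bar>z - x $ j\<bar> powr \<alpha>)"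

definition minimizers :: "real \<Rightarrow> real ^ 'n ^ 'n \<Rightarrow> 'n \<Rightarrow> real ^ 'n \<Rightarrow> real set" where
  "minimizers \<alpha> W i x = {z. is_arg_min (\<lambda>z. social_cost \<alpha> W i z x) (\<lambda>_. True) z}"

definition is_best_response ::
    "real \<Rightarrow> real ^ 'n ^ 'n \<Rightarrow> 'n \<Rightarrow> real ^ 'n \<Rightarrow> real \<Rightarrow> bool" where
  "is_best_response \<alpha> W i x b \<longleftrightarrow>
     b \<in> minimizers \<alpha> W i x \<and>
     (\<forall>z\<in>minimizers \<alpha> W i x. \<bar>b - x $ i\<bar> \<le> \<bar>z - x $ i\<bar>) \<and>
     (\<forall>z1\<in>minimizers \<alpha> W i x. \<forall>z2\<in>minimizers \<alpha> W i x.
        z1 \<noteq> z2 \<and>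
        (\<forall>z\<in>minimizers \<alpha> W i x. \<bar>z1 - x $ i\<bar> \<le> \<bar>z - x $ i\<bar>) \<and>
        (\<forall>z\<in>minimizers \<alpha> W i x. \<bar>z2 - x $ i\<bar> \<le> \<bar>z - x $ i\<bar>)
        \<longrightarrow> b = min z1 z2)"

text \<open>
  The definite description below is justified by \<open>ex1_is_best_response\<close>: a best response
  exists and is unique whenever \<open>W\<close> is row-stochastic and \<open>\<alpha> > 0\<close>.
\<close>

definition BR :: "real \<Rightarrow> real ^ 'n \<Rightarrow> real ^ 'n ^ 'n \<Rightarrow> real ^ 'n" where
  "BR \<alpha> x W = (\<chi> i. THE b. is_best_response \<alpha> W i x b)"

definition equilibrium ::
    "real \<Rightarrow> real \<Rightarrow> real ^ 'n ^ 'n \<Rightarrow> real ^ 'n \<Rightarrow> bool" where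
  "equilibrium \<alpha> \<beta> W x \<longleftrightarrow> x = \<beta> *\<^sub>R x + (1 - \<beta>) *\<^sub>R BR \<alpha> x W"

lemma continuous_on_social_cost:
  assumes "\<alpha> > 0"
  shows "continuous_on S (\<lambda>z. social_cost \<alpha> W i z x)"
  unfolding social_cost_def using assms
  by (intro continuous_intros continuous_on_powr') auto

lemma minimizers_iff:
  "z \<in> minimizers \<alpha> W i x \<longleftrightarrow> (\<forall>y. social_cost \<alpha> W i z x \<le> social_cost \<alpha> W i y x)"
  by (auto simp: minimizers_def is_arg_min_def not_less)

lemma social_cost_coercive:
  assumes W: "row_stochastic W" and \<alpha>: "\<alpha> > 0"
    and M: "\<And>j. \<bar>x $ j\<bar> \<le> M" and z: "\<bar>z\<bar> > 3 * M"
  shows "social_cost \<alpha> W i 0 x < social_cost \<alpha> W i z x"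
proof -
  have M0: "0 \<le> M" using M[of i] by linarith
  have nn: "0 \<le> W $ i $ j" for j using W by (auto simp: row_stochastic_def)
  have s1: "(\<Sum>j\<in>UNIV. W $ i $ j) = 1" using W by (auto simp: row_stochastic_def)
  have "social_cost \<alpha> W i 0 x \<le> (\<Sum>j\<in>UNIV. W $ i $ j * M powr \<alpha>)"
    unfolding social_cost_def
    by (intro sum_mono mult_left_mono nn powr_mono2) (use \<alpha> M in auto)
  also have "\<dots> = M powr \<alpha>" using s1 by (simp flip: sum_distrib_right)
  also have "\<dots> < (\<bar>z\<bar> - M) powr \<alpha>" 
    by (intro powr_less_mono2) (use \<alpha> M0 z in auto)
  also have "\<dots> = (\<Sum>j\<in>UNIV. W $ i $ j * (\<bar>z\<bar> - M) powr \<alpha>)"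
    using s1 by (simp flip: sum_distrib_right)
  also have "\<dots> \<le> social_cost \<alpha> W i z x"
    unfolding social_cost_def
  proof (intro sum_mono mult_left_mono nn powr_mono2)
    fix j show "\<bar>z\<bar> - M \<le> \<bar>z - x $ j\<bar>" using M[of j] by linarith
  qed (use \<alpha> M0 z in auto)
  finally show ?thesis .
qed

lemma minimizers_compact_nonempty:
  assumes W: "row_stochastic W" and \<alpha>: "\<alpha> > 0"
  shows "compact (minimizers \<alpha> W i x)" "minimizers \<alpha> W i x \<noteq> {}"
proof -
  define M where "M = norm x"
  have M: "\<bar>x $ j\<bar> \<le> M" for j by (simp add: M_def component_le_norm_cart)
  define K where "K = {-(3 * M)..3 * M}"
  have M0: "0 \<le> M" by (simp add: M_def)
  have out: "social_cost \<alpha> W i 0 x < social_cost \<alpha> W i z x" if "z \<notin> K" for z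
    using that by (intro social_cost_coercive[OF W \<alpha> M]) (auto simp: K_def abs_if)
  have "compact K" "0 \<in> K" using M0 by (auto simp: K_def)
  then obtain z where z: "z \<in> K" "\<And>y. y \<in> K \<Longrightarrow> social_cost \<alpha> W i z x \<le> social_cost \<alpha> W i y x"
    using continuous_attains_inf[OF \<open>compact K\<close> _ continuous_on_social_cost[OF \<alpha>, of K W i x]]
    by blast
  have "social_cost \<alpha> W i z x \<le> social_cost \<alpha> W i y x" for y
    using z(2)[of y] z(2)[OF \<open>0 \<in> K\<close>] out[of y] by (cases "y \<in> K") auto
  then show "minimizers \<alpha> W i x \<noteq> {}" by (auto simp: minimizers_iff set_eq_iff)
  have "minimizers \<alpha> W i x \<subseteq> K"
    by (meson minimizers_iff not_le out subsetI)
  moreover have "closed (minimizers \<alpha> W i x)"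
  proof -
    have "minimizers \<alpha> W i x
        = (\<Inter>y. {z. social_cost \<alpha> W i z x \<le> social_cost \<alpha> W i y x})"
      by (auto simp: minimizers_iff)
    also have "closed \<dots>"
      by (intro closed_INT ballI closed_Collect_le continuous_on_social_cost[OF \<alpha>]
          continuous_intros)
    finally show ?thesis .
  qed
  ultimately show "compact (minimizers \<alpha> W i x)"
    using \<open>compact K\<close> by (metis compact_Int_closed inf.absorb2)
qed

lemma ex1_is_best_response:
  assumes "row_stochastic W" and "\<alpha> > 0"
  shows "\<exists>!b. is_best_response \<alpha> W i x b"
proof -
  let ?A = "minimizers \<alpha> W i x"
  let ?N = "\<lambda>b. b \<in> ?A \<and> (\<forall>z\<in>?A. \<bar>b - x $ i\<bar> \<le> \<bar>z - x $ i\<bar>)"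
  note A = minimizers_compact_nonempty[OF assms, of i x]
  have cont: "continuous_on ?A (\<lambda>z. \<bar>z - x $ i\<bar>)" by (intro continuous_intros)
  obtain b where b: "?N b" using continuous_attains_inf[OF A cont] by blast
  have two: "\<bar>c - x $ i\<bar> = \<bar>b - x $ i\<bar>" if "?N c" for c
    using that b by (meson order_antisym)
  define c where "c = (if ?N (2 * x $ i - b) then min b (2 * x $ i - b) else b)"
  have c: "?N c" using b by (auto simp: c_def min_def)
  have le: "c \<le> d" if d: "?N d" for d
  proof -
    have "d = b \<or> d = 2 * x $ i - b" using two[OF d] by (auto simp: abs_if split: if_splits)
    then show ?thesis using d by (auto simp: c_def)
  qed
  have "is_best_response \<alpha> W i x c"
    unfolding is_best_response_def
  proof (intro conjI ballI impI)
    fix z1 z2 assume z: "z1 \<in> ?A" "z2 \<in> ?A"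
      "z1 \<noteq> z2 \<and> (\<forall>z\<in>?A. \<bar>z1 - x $ i\<bar> \<le> \<bar>z - x $ i\<bar>) \<and> (\<forall>z\<in>?A. \<bar>z2 - x $ i\<bar> \<le> \<bar>z - x $ i\<bar>)"
    then have n: "?N z1" "?N z2" by blast+
    show "c = min z1 z2"
      using le[OF n(1)] le[OF n(2)] two[OF n(1)] two[OF n(2)] two[OF c] z(3) by linarith
  qed (use c in auto)
  moreover have "d = e" if "is_best_response \<alpha> W i x d" "is_best_response \<alpha> W i x e" for d e
    using that unfolding is_best_response_def by metis
  ultimately show ?thesis by blast
qed

end

theory Submission
  imports Defs
begin

text \<open>
  For \<open>\<alpha> > 1\<close> the best-response operator is nonexpansive in the maximum norm
  \<^const>\<open>infnorm\<close>. The reason is that \<open>t \<mapsto> \<bar>t\<bar> powr \<alpha>\<close> is strictly convex: raising all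
  neighbours' opinions can only raise the minimizers of the social cost
  (\<open>minimizers_le_add\<close>), and shifting all opinions by a constant shifts the minimizers by
  the same constant. A monotone map that commutes with shifts by constants cannot increase the
  largest coordinatewise distance (\<open>BR_nonexpansive\<close>). It also fixes every consensus
  vector, in particular \<open>0\<close>.

  The dynamics is therefore a Krasnoselskii--Mann iteration, the average of the identity with a
  nonexpansive map \<open>T\<close> that has a fixed point, so its orbits are bounded and its step sizes
  decrease to some limit \<open>c\<close>. Along the orbit that starts in a cluster point \<open>y\<close> of the
  trajectory all steps have exactly the size \<open>c\<close>. In the maximum norm this forces a linear
  drift: a step is a proper convex combination of the previous step and of an increment of
  \<open>T\<close>, both of size at most \<open>c\<close>, so a coordinate that attains the extreme value \<open>c\<close> must
  have attained it, with the same sign, in all earlier steps (\<open>averaged_orbit_drift\<close>).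
  Boundedness leaves only \<open>c = 0\<close>, so that \<open>y\<close> is a fixed point. As distances to fixed points
  never grow, the whole trajectory converges to \<open>y\<close>.
\<close>

section \<open>Averaged iterations of maps that are nonexpansive in the maximum norm\<close>

lemma continuous_on_infnorm_nonexpansive:
  fixes T :: "'a::euclidean_space \<Rightarrow> 'a"
  assumes T: "\<And>u v. infnorm (T u - T v) \<le> infnorm (u - v)"
  shows "continuous_on S T"
proof -
  have "(sqrt DIM('a))-lipschitz_on S T"
  proof (rule lipschitz_onI)
    fix u v
    have "dist (T u) (T v) \<le> sqrt DIM('a) * infnorm (T u - T v)"
      unfolding dist_norm by (rule norm_le_infnorm)
    also have "\<dots> \<le> sqrt DIM('a) * infnorm (u - v)"
      by (intro mult_left_mono T) simp
    also have "\<dots> \<le> sqrt DIM('a) * dist u v"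
      unfolding dist_norm by (intro mult_left_mono infnorm_le_norm) simp
    finally show "dist (T u) (T v) \<le> sqrt DIM('a) * dist u v" .
  qed simp
  then show ?thesis by (rule lipschitz_on_continuous_on)
qed

lemma infnorm_averaged_le:
  fixes T :: "'a::euclidean_space \<Rightarrow> 'a"
  assumes T: "infnorm (T u - T v) \<le> infnorm (u - v)" and \<beta>: "0 \<le> \<beta>" "\<beta> \<le> 1"
  shows "infnorm ((\<beta> *\<^sub>R u + (1 - \<beta>) *\<^sub>R T u) - (\<beta> *\<^sub>R v + (1 - \<beta>) *\<^sub>R T v)) \<le> infnorm (u - v)"
proof -
  have "(\<beta> *\<^sub>R u + (1 - \<beta>) *\<^sub>R T u) - (\<beta> *\<^sub>R v + (1 - \<beta>) *\<^sub>R T v)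
      = \<beta> *\<^sub>R (u - v) + (1 - \<beta>) *\<^sub>R (T u - T v)"
    by (simp add: algebra_simps)
  also have "infnorm \<dots> \<le> \<beta> * infnorm (u - v) + (1 - \<beta>) * infnorm (T u - T v)"
    using infnorm_triangle[of "\<beta> *\<^sub>R (u - v)" "(1 - \<beta>) *\<^sub>R (T u - T v)"] \<beta>
    by (simp add: infnorm_mul)
  also have "\<dots> \<le> \<beta> * infnorm (u - v) + (1 - \<beta>) * infnorm (u - v)"
    using \<beta> by (intro add_left_mono mult_left_mono T) simp
  finally show ?thesis by (simp add: algebra_simps)
qed

text \<open>
  Two numbers bounded by \<open>c\<close> can only have a proper convex combination equal to \<open>c\<close> if both
  equal \<open>c\<close>. So an extreme coordinate of the last step was already extreme, with the same sign,
  in every earlier step, and these steps add up without any cancellation.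
\<close>
lemma averaged_orbit_drift:
  fixes T :: "'a::euclidean_space \<Rightarrow> 'a"
  assumes T: "\<And>u v. infnorm (T u - T v) \<le> infnorm (u - v)"
    and \<beta>: "0 < \<beta>" "\<beta> \<le> 1"
    and y: "\<And>k. y (Suc k) = \<beta> *\<^sub>R y k + (1 - \<beta>) *\<^sub>R T (y k)"
    and gap: "\<And>k. infnorm (y (Suc k) - y k) = c"
  shows "real (Suc m) * c \<le> infnorm (y (Suc m) - y 0)"
proof -
  define d where "d k = y (Suc k) - y k" for k
  have "infnorm (d m) \<in> (\<lambda>b. \<bar>d m \<bullet> b\<bar>) ` Basis"
    unfolding infnorm_Max by (intro Max_in) auto
  then obtain b where b: "b \<in> Basis" "\<bar>d m \<bullet> b\<bar> = c"
    using gap by (auto simp: d_def)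
  define e where "e = (if d m \<bullet> b \<ge> 0 then b else - b)"
  have e_le: "v \<bullet> e \<le> infnorm v" for v
    using Basis_le_infnorm[OF b(1), of v] by (auto simp: e_def)
  have extreme: "d k \<bullet> e = c" if "k \<le> m" for k
    using that
  proof (induction rule: inc_induct)
    case base
    show ?case using b(2) by (auto simp: e_def)
  next
    case (step k)
    have "d (Suc k) = \<beta> *\<^sub>R d k + (1 - \<beta>) *\<^sub>R (T (y (Suc k)) - T (y k))"
      using y[of k] y[of "Suc k"] by (simp add: d_def algebra_simps)
    then have "c = \<beta> * (d k \<bullet> e) + (1 - \<beta>) * ((T (y (Suc k)) - T (y k)) \<bullet> e)"
      using step.IH by (simp add: inner_add_left)
    also have "\<dots> \<le> \<beta> * (d k \<bullet> e) + (1 - \<beta>) * c"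
      using \<beta> e_le[of "T (y (Suc k)) - T (y k)"] T[of "y (Suc k)" "y k"] gap[of k]
      by (intro add_left_mono mult_left_mono) auto
    finally have "\<beta> * c \<le> \<beta> * (d k \<bullet> e)" by (simp add: algebra_simps)
    then have "c \<le> d k \<bullet> e" using \<beta> by simp
    then show ?case using e_le[of "d k"] gap[of k] by (simp add: d_def)
  qed
  have "y (Suc m) - y 0 = (\<Sum>k<Suc m. d k)"
    unfolding d_def by (rule sum_lessThan_telescope[symmetric])
  then have "(y (Suc m) - y 0) \<bullet> e = (\<Sum>k<Suc m. d k \<bullet> e)"
    by (simp only: inner_sum_left)
  also have "\<dots> = (\<Sum>k<Suc m. c)" by (intro sum.cong extreme) auto
  finally show ?thesis using e_le[of "y (Suc m) - y 0"] by simp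
qed

text \<open>
  The step sizes need not be constant along the trajectory itself, only in the limit. Passing to
  the orbit of a cluster point makes them constant, which is what the drift argument needs.
\<close>
theorem averaged_iteration_converges:
  fixes T :: "'a::euclidean_space \<Rightarrow> 'a"
  assumes T: "\<And>u v. infnorm (T u - T v) \<le> infnorm (u - v)"
    and p: "T p = p"
    and \<beta>: "0 < \<beta>" "\<beta> < 1"
    and x: "\<And>k. x (Suc k) = \<beta> *\<^sub>R x k + (1 - \<beta>) *\<^sub>R T (x k)"
  shows "\<exists>q. T q = q \<and> x \<longlonglongrightarrow> q"
proof -
  define F where "F u = \<beta> *\<^sub>R u + (1 - \<beta>) *\<^sub>R T u" for u
  have F: "infnorm (F u - F v) \<le> infnorm (u - v)" for u v
    unfolding F_def using T \<beta> by (intro infnorm_averaged_le) auto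
  have F_fixed: "F q = q \<longleftrightarrow> T q = q" for q
  proof -
    have "F q - q = (1 - \<beta>) *\<^sub>R (T q - q)" by (simp add: F_def algebra_simps)
    then show ?thesis using \<beta>
      by (metis diff_gt_0_iff_gt eq_iff_diff_eq_0 less_irrefl scaleR_eq_0_iff)
  qed
  have xF: "x (Suc k) = F (x k)" for k by (simp add: x F_def)
  have x_funpow: "x (k + m) = (F ^^ m) (x k)" for k m
    by (induction m) (auto simp: xF)
  have dist_fixed: "decseq (\<lambda>k. infnorm (x k - q))" if "F q = q" for q
    using F[of "x _" q] that by (intro decseq_SucI) (auto simp: xF)

  have bound: "infnorm (x k - p) \<le> infnorm (x 0 - p)" for k
    using dist_fixed[of p] F_fixed[of p] p by (auto simp: decseq_def)
  have "norm (x k) \<le> norm p + sqrt DIM('a) * infnorm (x 0 - p)" for k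
  proof -
    have "norm (x k - p) \<le> sqrt DIM('a) * infnorm (x k - p)" by (rule norm_le_infnorm)
    also have "\<dots> \<le> sqrt DIM('a) * infnorm (x 0 - p)" by (intro mult_left_mono bound) simp
    finally show ?thesis using norm_triangle_sub[of "x k" p] by linarith
  qed
  then have "bounded (range x)" by (auto intro!: boundedI)
  then obtain y r where r: "strict_mono r" and y: "(x \<circ> r) \<longlonglongrightarrow> y"
    using bounded_imp_convergent_subsequence by blast

  have "decseq (\<lambda>k. infnorm (x (Suc k) - x k))"
    using F by (intro decseq_SucI) (auto simp: xF)
  moreover have "0 \<le> infnorm (x (Suc k) - x k)" for k by (rule infnorm_pos_le)
  ultimately obtain c where c: "(\<lambda>k. infnorm (x (Suc k) - x k)) \<longlonglongrightarrow> c"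
    using decseq_convergent by blast

  have cont: "continuous_on UNIV (F ^^ m)" for m
  proof (induction m)
    case (Suc m)
    have "continuous_on UNIV F" by (rule continuous_on_infnorm_nonexpansive[OF F])
    with Suc show ?case
      by (simp add: continuous_on_compose2[of UNIV F UNIV] o_def)
  qed (simp add: id_def)
  have shifted: "(\<lambda>n. x (r n + m)) \<longlonglongrightarrow> (F ^^ m) y" for m
    unfolding x_funpow using y cont[of m]
    by (auto simp: o_def continuous_on_eq_continuous_at intro: isCont_tendsto_compose)
  \<comment> \<open>The orbit of \<open>y\<close> is a limit of tails of the trajectory and inherits their limiting step size.\<close>
  have gap: "infnorm ((F ^^ Suc m) y - (F ^^ m) y) = c" for m
  proof (rule LIMSEQ_unique)
    show "(\<lambda>n. infnorm (x (r n + Suc m) - x (r n + m)))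
        \<longlonglongrightarrow> infnorm ((F ^^ Suc m) y - (F ^^ m) y)"
      by (intro tendsto_infnorm tendsto_diff shifted)
    have "filterlim (\<lambda>n. r n + m) at_top sequentially"
      using filterlim_subseq[OF r] by (rule filterlim_at_top_mono) auto
    from filterlim_compose[OF c this]
    show "(\<lambda>n. infnorm (x (r n + Suc m) - x (r n + m))) \<longlonglongrightarrow> c" by simp
  qed

  have orbit_bound: "infnorm ((F ^^ m) y - y) \<le> 2 * infnorm (x 0 - p)" for m
  proof (rule tendsto_upperbound)
    show "(\<lambda>n. infnorm (x (r n + m) - x (r n + 0))) \<longlonglongrightarrow> infnorm ((F ^^ m) y - y)"
      using shifted[of 0] by (intro tendsto_infnorm tendsto_diff shifted) simp
    have "infnorm (x k - x l) \<le> 2 * infnorm (x 0 - p)" for k l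
      using infnorm_triangle[of "x k - p" "p - x l"] bound[of k] bound[of l]
        infnorm_sub[of "x l" p] by simp
    then show "\<forall>\<^sub>F n in sequentially. infnorm (x (r n + m) - x (r n + 0)) \<le> 2 * infnorm (x 0 - p)"
      by simp
  qed simp
  have "real (Suc m) * c \<le> 2 * infnorm (x 0 - p)" for m
    using averaged_orbit_drift[where y = "\<lambda>k. (F ^^ k) y", OF T, of \<beta> c m] \<beta> gap
      orbit_bound[of "Suc m"]
    by (fastforce simp: F_def)
  moreover have "0 \<le> c" using gap[of 0] infnorm_pos_le by metis
  moreover have "\<exists>m. 2 * infnorm (x 0 - p) < real (Suc m) * c" if "0 < c"
  proof -
    obtain m where "2 * infnorm (x 0 - p) < real m * c"
      using ex_less_of_nat_mult[OF \<open>0 < c\<close>] by blast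
    also have "\<dots> \<le> real (Suc m) * c" using that by (intro mult_right_mono) auto
    finally show ?thesis by blast
  qed
  ultimately have "c = 0" by (meson not_less order_le_less)
  then have y_fixed: "F y = y" using gap[of 0] by (simp add: infnorm_eq_0)

  \<comment> \<open>The distances to the fixed point \<open>y\<close> decrease and tend to \<open>0\<close> along a subsequence.\<close>
  obtain l where l: "(\<lambda>k. infnorm (x k - y)) \<longlonglongrightarrow> l"
    using decseq_convergent[OF dist_fixed[OF y_fixed]] infnorm_pos_le by blast
  have "(\<lambda>n. infnorm ((x \<circ> r) n - y)) \<longlonglongrightarrow> infnorm (y - y)"
    by (intro tendsto_infnorm tendsto_diff y tendsto_const)
  then have "l = 0"
    using LIMSEQ_subseq_LIMSEQ[OF l r] LIMSEQ_unique by (fastforce simp: o_def infnorm_0)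
  with l have "(\<lambda>k. sqrt DIM('a) * infnorm (x k - y)) \<longlonglongrightarrow> 0"
    by (auto intro: tendsto_mult_right_zero)
  then have "(\<lambda>k. x k - y) \<longlonglongrightarrow> 0"
    by (rule Lim_null_comparison[rotated]) (simp add: norm_le_infnorm)
  then have "x \<longlonglongrightarrow> y" by (simp add: LIM_zero_iff)
  with y_fixed F_fixed show ?thesis by blast
qed

section \<open>The best response is nonexpansive\<close>

lemma has_real_derivative_abs_powr:
  fixes \<alpha> t :: real
  assumes "\<alpha> > 1"
  shows "((\<lambda>t. \<bar>t\<bar> powr \<alpha>) has_real_derivative \<alpha> * sgn t * \<bar>t\<bar> powr (\<alpha> - 1)) (at t)"
proof (cases "t = 0")
  case False
  have "((\<lambda>s. sgn t * s) has_real_derivative sgn t) (at t)"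
    by (auto intro!: derivative_eq_intros)
  then have "(abs has_real_derivative sgn t) (at t)"
  proof (rule has_field_derivative_transform_within)
    show "0 < \<bar>t\<bar>" using False by simp
    show "sgn t * s = \<bar>s\<bar>" if "dist s t < \<bar>t\<bar>" for s
      using that by (auto simp: sgn_if dist_real_def abs_if split: if_splits)
  qed simp
  from DERIV_chain2[OF DERIV_powr[OF DERIV_ident _ DERIV_const, of "\<bar>t\<bar>" \<alpha>] this] False
  show ?thesis by (simp add: powr_diff field_simps)
next
  case True
  \<comment> \<open>The difference quotient at \<open>0\<close> has absolute value \<open>\<bar>s\<bar> powr (\<alpha> - 1)\<close>, which vanishes as \<open>s\<close> tends to \<open>0\<close>.\<close>
  have "((\<lambda>s::real. \<bar>s\<bar> powr (\<alpha> - 1)) \<longlongrightarrow> \<bar>0\<bar> powr (\<alpha> - 1)) (at 0)"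
    using assms by (intro tendsto_intros tendsto_powr') auto
  then have "((\<lambda>s::real. \<bar>s\<bar> powr (\<alpha> - 1)) \<longlongrightarrow> 0) (at 0)" by simp
  then have "((\<lambda>s::real. \<bar>s\<bar> powr \<alpha> / s) \<longlongrightarrow> 0) (at 0)"
    by (rule Lim_null_comparison[rotated])
       (auto simp: eventually_at_filter powr_diff)
  then show ?thesis using True by (simp add: DERIV_def)
qed

text \<open>
  This is strict convexity in the form in which the optimality conditions of two competing
  minimizers can be compared: the price of moving up by \<open>h\<close> is the larger, the higher the
  starting point.
\<close>
lemma abs_powr_increment_strict_mono:
  fixes \<alpha> a b h :: real
  assumes "\<alpha> > 1" "a < b" "h > 0"
  shows "\<bar>a + h\<bar> powr \<alpha> - \<bar>a\<bar> powr \<alpha> < \<bar>b + h\<bar> powr \<alpha> - \<bar>b\<bar> powr \<alpha>"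
proof -
  have slope_mono: "sgn s * \<bar>s\<bar> powr (\<alpha> - 1) < sgn t * \<bar>t\<bar> powr (\<alpha> - 1)" if "s < t" for s t :: real
  proof -
    define p where "p u = \<bar>u\<bar> powr (\<alpha> - 1)" for u :: real
    have p_pos: "0 < p u" if "u \<noteq> 0" for u using that by (simp add: p_def)
    have p_mono: "p u < p v" if "\<bar>u\<bar> < \<bar>v\<bar>" for u v
      unfolding p_def using that assms(1) by (intro powr_less_mono2) auto
    have "sgn s * p s < sgn t * p t"
      using that p_pos[of s] p_pos[of t] p_mono[of s t] p_mono[of t s]
      by (cases s "0::real" rule: linorder_cases; cases t "0::real" rule: linorder_cases) auto
    then show ?thesis by (simp add: p_def)
  qed
  show ?thesis
  proof (rule DERIV_pos_imp_increasing[OF \<open>a < b\<close>], intro exI conjI)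
    fix t
    show "((\<lambda>t. \<bar>t + h\<bar> powr \<alpha> - \<bar>t\<bar> powr \<alpha>) has_real_derivative
        \<alpha> * sgn (t + h) * \<bar>t + h\<bar> powr (\<alpha> - 1) - \<alpha> * sgn t * \<bar>t\<bar> powr (\<alpha> - 1)) (at t)"
      using has_real_derivative_abs_powr[OF assms(1)]
      by (intro DERIV_diff DERIV_shift[THEN iffD1, of "\<lambda>t. \<bar>t\<bar> powr \<alpha>"])
    show "0 < \<alpha> * sgn (t + h) * \<bar>t + h\<bar> powr (\<alpha> - 1) - \<alpha> * sgn t * \<bar>t\<bar> powr (\<alpha> - 1)"
      using slope_mono[of t "t + h"] assms by (simp add: mult.assoc)
  qed
qed

text \<open>
  Suppose \<open>z' + d < z\<close>. As \<open>z\<close> is optimal, moving up from \<open>z' + d\<close> to \<open>z\<close> does not raise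
  the cost at \<open>x\<close>; as \<open>z'\<close> is optimal, the equally long move from \<open>z'\<close> to \<open>z - d\<close> does not
  lower the cost at \<open>x'\<close>. But relative to each neighbour's opinion the first move starts
  higher than the second, so it must be strictly more expensive.
\<close>
lemma minimizers_less_mono:
  assumes W: "row_stochastic W" and \<alpha>: "\<alpha> > 1"
    and less: "\<And>j. x $ j < x' $ j + d"
    and z: "z \<in> minimizers \<alpha> W i x" and z': "z' \<in> minimizers \<alpha> W i x'"
  shows "z \<le> z' + d"
proof (rule ccontr)
  assume "\<not> z \<le> z' + d"
  then have h: "0 < z - z' - d" by simp
  define A where "A j = \<bar>z - x $ j\<bar> powr \<alpha> - \<bar>z' + d - x $ j\<bar> powr \<alpha>" for j
  define B where "B j = \<bar>z - d - x' $ j\<bar> powr \<alpha> - \<bar>z' - x' $ j\<bar> powr \<alpha>" for j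
  have BA: "B j < A j" for j
    using abs_powr_increment_strict_mono[OF \<alpha> _ h, of "z' - x' $ j" "z' + d - x $ j"] less[of j]
    by (simp add: A_def B_def algebra_simps)
  have W0: "0 \<le> W $ i $ j" for j using W by (simp add: row_stochastic_def)
  have "(\<Sum>j\<in>UNIV. W $ i $ j) = 1" using W by (simp add: row_stochastic_def)
  then obtain j where "W $ i $ j \<noteq> 0" by (metis sum.neutral zero_neq_one)
  with W0[of j] BA[of j] have "W $ i $ j * B j < W $ i $ j * A j" by simp
  then have "(\<Sum>j\<in>UNIV. W $ i $ j * B j) < (\<Sum>j\<in>UNIV. W $ i $ j * A j)"
    using BA W0 by (intro sum_strict_mono_ex1) (auto intro!: mult_left_mono less_imp_le[OF BA])
  also have "\<dots> = social_cost \<alpha> W i z x - social_cost \<alpha> W i (z' + d) x"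
    by (simp add: social_cost_def A_def right_diff_distrib sum_subtractf)
  also have "\<dots> \<le> 0" using z by (simp add: minimizers_iff)
  also have "0 \<le> social_cost \<alpha> W i (z - d) x' - social_cost \<alpha> W i z' x'"
    using z' by (simp add: minimizers_iff)
  also have "\<dots> = (\<Sum>j\<in>UNIV. W $ i $ j * B j)"
    by (simp add: social_cost_def B_def right_diff_distrib sum_subtractf)
  finally show False by simp
qed

text \<open>
  The strict comparison is applied with a slightly larger shift. In this way even ties are
  covered without a separate proof that minimizers are unique; uniqueness is the case
  \<open>x = x'\<close>, \<open>d = 0\<close>.
\<close>
lemma minimizers_le_add:
  assumes "row_stochastic W" "\<alpha> > 1"
    and le: "\<And>j. x $ j \<le> x' $ j + d"
    and "z \<in> minimizers \<alpha> W i x" "z' \<in> minimizers \<alpha> W i x'"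
  shows "z \<le> z' + d"
proof (rule field_le_epsilon)
  fix e :: real assume "0 < e"
  then have "x $ j < x' $ j + (d + e)" for j using le[of j] by linarith
  from minimizers_less_mono[OF assms(1,2) this assms(4,5)]
  show "z \<le> z' + d + e" by simp
qed

lemma BR_minimizer:
  assumes "row_stochastic W" "\<alpha> > 0"
  shows "BR \<alpha> x W $ i \<in> minimizers \<alpha> W i x"
proof -
  have "is_best_response \<alpha> W i x (BR \<alpha> x W $ i)"
    unfolding BR_def using theI'[OF ex1_is_best_response[OF assms]] by simp
  then show ?thesis by (simp add: is_best_response_def)
qed

lemma BR_nonexpansive:
  assumes W: "row_stochastic W" and \<alpha>: "\<alpha> > 1"
  shows "infnorm (BR \<alpha> x W - BR \<alpha> y W) \<le> infnorm (x - y)"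
proof -
  have comp: "\<bar>x $ j - y $ j\<bar> \<le> infnorm (x - y)" for j
    using component_le_infnorm_cart[of "x - y" j] by simp
  have min: "BR \<alpha> u W $ i \<in> minimizers \<alpha> W i u" for u i
    using BR_minimizer[OF W] \<alpha> by simp
  have le: "x $ j \<le> y $ j + infnorm (x - y)" "y $ j \<le> x $ j + infnorm (x - y)" for j
    using comp[of j] by linarith+
  have "\<bar>(BR \<alpha> x W - BR \<alpha> y W) $ i\<bar> \<le> infnorm (x - y)" for i
    using minimizers_le_add[OF W \<alpha> le(1) min min, of i] minimizers_le_add[OF W \<alpha> le(2) min min, of i]
    by (simp add: abs_le_iff)
  then show ?thesis
    unfolding infnorm_cart by (intro cSup_least) auto
qed

text \<open>At the consensus \<open>0\<close> the cost vanishes in \<open>0\<close>, its least possible value.\<close>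
lemma BR_0:
  assumes W: "row_stochastic W" and \<alpha>: "\<alpha> > 1"
  shows "BR \<alpha> 0 W = 0"
proof -
  have "0 \<in> minimizers \<alpha> W i 0" for i
    using W by (auto simp: minimizers_iff social_cost_def row_stochastic_def intro!: sum_nonneg)
  moreover have "BR \<alpha> 0 W $ i \<in> minimizers \<alpha> W i 0" for i
    using BR_minimizer[OF W] \<alpha> by simp
  ultimately have "BR \<alpha> 0 W $ i = 0" for i
    using minimizers_le_add[OF W \<alpha>, of 0 0 0] by (metis add.right_neutral order.antisym order_refl)
  then show ?thesis by (simp add: vec_eq_iff)
qed

section \<open>Convergence of the best-response dynamics\<close>

theorem theorem2:
  fixes W :: "real ^ 'n ^ 'n" and \<alpha> \<beta> :: real and x :: "nat \<Rightarrow> real ^ 'n"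
  assumes "row_stochastic W"
    and "0 < \<beta>" and "\<beta> < 1"
    and "\<alpha> > 1"
    and "\<forall>k. x (Suc k) = \<beta> *\<^sub>R x k + (1 - \<beta>) *\<^sub>R BR \<alpha> (x k) W"
  shows "\<exists>x_star. equilibrium \<alpha> \<beta> W x_star \<and> x \<longlonglongrightarrow> x_star"
proof -
  obtain q where q: "BR \<alpha> q W = q" "x \<longlonglongrightarrow> q"
    using averaged_iteration_converges[of "\<lambda>u. BR \<alpha> u W" 0 \<beta> x]
      BR_nonexpansive[OF assms(1,4)] BR_0[OF assms(1,4)] assms(2,3,5) by blast
  have "equilibrium \<alpha> \<beta> W q"
    by (simp add: equilibrium_def q(1) flip: scaleR_left_distrib)
  with q(2) show ?thesis by blast
qed

end
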